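(* Let $F:\mathbb{A}\to\mathbb{B}$ and $G:\mathbb{B}\to\mathbb{A}$ be functors between arbitrary categories with $F$ left adjoint to $G$, with unit $\eta:\mathrm{Id}_{\mathbb{A}}\to GF$ and counit $\varepsilon:FG\to \mathrm{Id}_{\mathbb{B}}$. Suppose $(F,G)$ is a pair of $\star$-functors. Then the functors $$\widetilde F:\mathbb{A}_{GF}\to\mathbb{B}^{FG},\ (A,\rho_A)\mapsto(F(A),F\eta_A),\qquad \widetilde G:\mathbb{B}^{FG}\to\mathbb{A}_{GF},\ (B,\rho^B)\mapsto(G(B),G\varepsilon_B),$$ induce an equivalence, where $\mathbb{A}_{GF}=\mathrm{Fix}(GF,\eta)$ is a reflective subcategory of $\mathbb{A}$ closed under subobjects in $\mathbb{A}$, and $\mathbb{B}^{FG}=\mathrm{Fix}(FG,\varepsilon)$ is a coreflective subcategory of $\mathbb{B}$ closed under factor objects in $\mathbb{B}$.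
   Context: An epimorphism $e$ is called extremal if whenever $e=m\circ f$ with $m$ a monomorphism, then $m$ is an isomorphism. A monomorphism $m$ is called extremal if whenever $m=f\circ e$ with $e$ an epimorphism, then $e$ is an isomorphism. An adjoint pair $(F,G)$ with unit $\eta$ and counit $\varepsilon$ is a pair of $\star$-functors if $\eta_A:A\to GF(A)$ is an extremal epimorphism for all $A\in\mathbb{A}$ and $\varepsilon_B:FG(B)\to B$ is an extremal monomorphism for all $B\in\mathbb{B}$. $GF$ denotes the monad $(GF,\,G\varepsilon F,\,\eta)$ on $\mathbb{A}$ and $FG$ the comonad $(FG,\,F\eta G,\,\varepsilon)$ on $\mathbb{B}$. $\mathbb{A}_{GF}$ is the category of modules (Eilenberg–Moore algebras) $(A,\rho_A:GF(A)\to A)$ of the monad $GF$, and $\mathbb{B}^{FG}$ the category of comodules (Eilenberg–Moore coalgebras) $(B,\rho^B:B\to FG(B))$ of the comonad $FG$. On morphisms, $\widetilde F$ and $\widetilde G$ act as $F$ and $G$. $\mathrm{Fix}(GF,\eta)$ is the full subcategory of $\mathbb{A}$ of those $A$ for which $\eta_A$ is an isomorphism; $\mathrm{Fix}(FG,\varepsilon)$ is the full subcategory of $\mathbb{B}$ of those $B$ for which $\varepsilon_B$ is an isomorphism. The identifications $\mathbb{A}_{GF}=\mathrm{Fix}(GF,\eta)$ and $\mathbb{B}^{FG}=\mathrm{Fix}(FG,\varepsilon)$ are via the forgetful functors $\mathbb{A}_{GF}\to\mathbb{A}$ and $\mathbb{B}^{FG}\to\mathbb{B}$ (which restrict to equivalences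 onto these full subcategories). Closed under subobjects means: if $A\to A'$ is a monomorphism in $\mathbb{A}$ and $A'$ lies in the subcategory, so does $A$. Closed under factor objects means: if $B'\to B$ is an epimorphism in $\mathbb{B}$ and $B'$ lies in the subcategory, so does $B$. *)

theory Defs
  imports Main
begin

section \<open>Categories\<close>

record ('o, 'm) category =
  Obj :: "'o set"
  Arr :: "'m set"
  Dom :: "'m \<Rightarrow> 'o"
  Cod :: "'m \<Rightarrow> 'o"
  Ident :: "'o \<Rightarrow> 'm"
  Comp :: "'m \<Rightarrow> 'm \<Rightarrow> 'm" (infixr "\<cdot>\<index>" 70)

definition Hom :: "('o, 'm) category \<Rightarrow> 'o \<Rightarrow> 'o \<Rightarrow> 'm set" where
  "Hom C a b = {f \<in> Arr C. Dom C f = a \<and> Cod C f = b}"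

locale category =
  fixes C :: "('o, 'm) category" (structure)
  assumes Dom_in_Obj: "f \<in> Arr C \<Longrightarrow> Dom C f \<in> Obj C"
    and Cod_in_Obj: "f \<in> Arr C \<Longrightarrow> Cod C f \<in> Obj C"
    and Ident_in_Hom: "a \<in> Obj C \<Longrightarrow> Ident C a \<in> Hom C a a"
    and Comp_in_Hom: "\<lbrakk>f \<in> Hom C a b; g \<in> Hom C b c\<rbrakk> \<Longrightarrow> g \<cdot> f \<in> Hom C a c"
    and Comp_Ident_left: "f \<in> Hom C a b \<Longrightarrow> Ident C b \<cdot> f = f"
    and Comp_Ident_right: "f \<in> Hom C a b \<Longrightarrow> f \<cdot> Ident C a = f"
    and Comp_assoc: "\<lbrakk>f \<in> Hom C a b; g \<in> Hom C b c; h \<in> Hom C c d\<rbrakk>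
                      \<Longrightarrow> (h \<cdot> g) \<cdot> f = h \<cdot> (g \<cdot> f)"

definition monomorphism :: "('o, 'm) category \<Rightarrow> 'm \<Rightarrow> bool" where
  "monomorphism C m \<longleftrightarrow> m \<in> Arr C \<and>
     (\<forall>x. \<forall>f \<in> Hom C x (Dom C m). \<forall>g \<in> Hom C x (Dom C m).
        m \<cdot>\<^bsub>C\<^esub> f = m \<cdot>\<^bsub>C\<^esub> g \<longrightarrow> f = g)"

definition epimorphism :: "('o, 'm) category \<Rightarrow> 'm \<Rightarrow> bool" where
  "epimorphism C e \<longleftrightarrow> e \<in> Arr C \<and>
     (\<forall>x. \<forall>f \<in> Hom C (Cod C e) x. \<forall>g \<in> Hom C (Cod C e) x.
        f \<cdot>\<^bsub>C\<^esub> e = g \<cdot>\<^bsub>C\<^esub> e \<longrightarrow> f = g)"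

definition isomorphism :: "('o, 'm) category \<Rightarrow> 'm \<Rightarrow> bool" where
  "isomorphism C f \<longleftrightarrow> f \<in> Arr C \<and>
     (\<exists>g \<in> Hom C (Cod C f) (Dom C f).
        g \<cdot>\<^bsub>C\<^esub> f = Ident C (Dom C f) \<and> f \<cdot>\<^bsub>C\<^esub> g = Ident C (Cod C f))"

definition extremal_epimorphism :: "('o, 'm) category \<Rightarrow> 'm \<Rightarrow> bool" where
  "extremal_epimorphism C e \<longleftrightarrow> epimorphism C e \<and>
     (\<forall>m \<in> Arr C. \<forall>f \<in> Arr C.
        Cod C f = Dom C m \<and> e = m \<cdot>\<^bsub>C\<^esub> f \<and> monomorphism C m \<longrightarrow> isomorphism C m)"

definition extremal_monomorphism :: "('o, 'm) category \<Rightarrow> 'm \<Rightarrow> bool" where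
  "extremal_monomorphism C m \<longleftrightarrow> monomorphism C m \<and>
     (\<forall>f \<in> Arr C. \<forall>e \<in> Arr C.
        Cod C e = Dom C f \<and> m = f \<cdot>\<^bsub>C\<^esub> e \<and> epimorphism C e \<longrightarrow> isomorphism C e)"


section \<open>Functors, natural transformations, adjunctions, equivalences\<close>

record ('o, 'm, 'p, 'n) functor_data =
  ObjMap :: "'o \<Rightarrow> 'p"
  ArrMap :: "'m \<Rightarrow> 'n"

locale is_functor = C: category C + D: category D
  for C :: "('o, 'm) category" and D :: "('p, 'n) category"
    and F :: "('o, 'm, 'p, 'n) functor_data" +
  assumes ObjMap_in_Obj: "a \<in> Obj C \<Longrightarrow> ObjMap F a \<in> Obj D"
    and ArrMap_in_Hom: "f \<in> Hom C a b \<Longrightarrow> ArrMap F f \<in> Hom D (ObjMap F a) (ObjMap F b)"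
    and ArrMap_Ident: "a \<in> Obj C \<Longrightarrow> ArrMap F (Ident C a) = Ident D (ObjMap F a)"
    and ArrMap_Comp: "\<lbrakk>f \<in> Hom C a b; g \<in> Hom C b c\<rbrakk>
                       \<Longrightarrow> ArrMap F (g \<cdot>\<^bsub>C\<^esub> f) = ArrMap F g \<cdot>\<^bsub>D\<^esub> ArrMap F f"

definition id_functor :: "('o, 'm, 'o, 'm) functor_data" where
  "id_functor = \<lparr>ObjMap = (\<lambda>a. a), ArrMap = (\<lambda>f. f)\<rparr>"

definition comp_functor ::
    "('p, 'n, 'q, 'k) functor_data \<Rightarrow> ('o, 'm, 'p, 'n) functor_data \<Rightarrow> ('o, 'm, 'q, 'k) functor_data"
    (infixr "\<circ>\<^sub>F" 75) where
  "G \<circ>\<^sub>F F = \<lparr>ObjMap = (\<lambda>a. ObjMap G (ObjMap F a)), ArrMap = (\<lambda>f. ArrMap G (ArrMap F f))\<rparr>"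

locale natural_transformation = F: is_functor C D F + G: is_functor C D G
  for C :: "('o, 'm) category" and D :: "('p, 'n) category" and F G
    and \<tau> :: "'o \<Rightarrow> 'n" +
  assumes component_in_Hom: "a \<in> Obj C \<Longrightarrow> \<tau> a \<in> Hom D (ObjMap F a) (ObjMap G a)"
    and naturality: "f \<in> Hom C a b \<Longrightarrow> ArrMap G f \<cdot>\<^bsub>D\<^esub> \<tau> a = \<tau> b \<cdot>\<^bsub>D\<^esub> ArrMap F f"

locale natural_isomorphism = natural_transformation +
  assumes component_iso: "a \<in> Obj C \<Longrightarrow> isomorphism D (\<tau> a)"

locale adjunction =
  F: is_functor A B F + G: is_functor B A G +
  unit: natural_transformation A A id_functor "G \<circ>\<^sub>F F" \<eta> +
  counit: natural_transformation B B "F \<circ>\<^sub>F G" id_functor \<epsilon>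
  for A :: "('o, 'm) category" and B :: "('p, 'n) category" and F G \<eta> \<epsilon> +
  assumes triangle_left:
      "a \<in> Obj A \<Longrightarrow> \<epsilon> (ObjMap F a) \<cdot>\<^bsub>B\<^esub> ArrMap F (\<eta> a) = Ident B (ObjMap F a)"
    and triangle_right:
      "b \<in> Obj B \<Longrightarrow> ArrMap G (\<epsilon> b) \<cdot>\<^bsub>A\<^esub> \<eta> (ObjMap G b) = Ident A (ObjMap G b)"

definition equivalence ::
    "('o, 'm) category \<Rightarrow> ('p, 'n) category
      \<Rightarrow> ('o, 'm, 'p, 'n) functor_data \<Rightarrow> ('p, 'n, 'o, 'm) functor_data \<Rightarrow> bool" where
  "equivalence C D F G \<longleftrightarrow> is_functor C D F \<and> is_functor D C G \<and>
     (\<exists>\<tau>. natural_isomorphism C C id_functor (G \<circ>\<^sub>F F) \<tau>) \<and>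
     (\<exists>\<sigma>. natural_isomorphism D D (F \<circ>\<^sub>F G) id_functor \<sigma>)"

definition equivalence_functor ::
    "('o, 'm) category \<Rightarrow> ('p, 'n) category \<Rightarrow> ('o, 'm, 'p, 'n) functor_data \<Rightarrow> bool" where
  "equivalence_functor C D F \<longleftrightarrow> (\<exists>G. equivalence C D F G)"

definition star_functors ::
    "('o, 'm) category \<Rightarrow> ('p, 'n) category
      \<Rightarrow> ('o, 'm, 'p, 'n) functor_data \<Rightarrow> ('p, 'n, 'o, 'm) functor_data
      \<Rightarrow> ('o \<Rightarrow> 'm) \<Rightarrow> ('p \<Rightarrow> 'n) \<Rightarrow> bool" where
  "star_functors A B F G \<eta> \<epsilon> \<longleftrightarrow> adjunction A B F G \<eta> \<epsilon> \<and>
     (\<forall>a \<in> Obj A. extremal_epimorphism A (\<eta> a)) \<and>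
     (\<forall>b \<in> Obj B. extremal_monomorphism B (\<epsilon> b))"


section \<open>Subcategories\<close>

definition subcategory :: "('o, 'm) category \<Rightarrow> ('o, 'm) category \<Rightarrow> bool" where
  "subcategory C S \<longleftrightarrow> category C \<and> category S \<and> Obj S \<subseteq> Obj C \<and> Arr S \<subseteq> Arr C \<and>
     (\<forall>f \<in> Arr S. Dom S f = Dom C f \<and> Cod S f = Cod C f) \<and>
     (\<forall>a \<in> Obj S. Ident S a = Ident C a) \<and>
     (\<forall>f \<in> Arr S. \<forall>g \<in> Arr S. Cod S f = Dom S g \<longrightarrow> g \<cdot>\<^bsub>S\<^esub> f = g \<cdot>\<^bsub>C\<^esub> f)"

definition full_subcategory_on :: "('o, 'm) category \<Rightarrow> 'o set \<Rightarrow> ('o, 'm) category" where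
  "full_subcategory_on C X =
     C\<lparr>Obj := Obj C \<inter> X, Arr := {f \<in> Arr C. Dom C f \<in> X \<and> Cod C f \<in> X}\<rparr>"

text \<open>In the next two definitions \<^const>\<open>id_functor\<close> plays the role of the inclusion
  functor from \<open>S\<close> to \<open>C\<close>.\<close>

definition reflective_subcategory :: "('o, 'm) category \<Rightarrow> ('o, 'm) category \<Rightarrow> bool" where
  "reflective_subcategory C S \<longleftrightarrow> subcategory C S \<and>
     (\<exists>L \<eta> \<epsilon>. adjunction C S L id_functor \<eta> \<epsilon>)"

definition coreflective_subcategory :: "('o, 'm) category \<Rightarrow> ('o, 'm) category \<Rightarrow> bool" where
  "coreflective_subcategory C S \<longleftrightarrow> subcategory C S \<and>
     (\<exists>R \<eta> \<epsilon>. adjunction S C id_functor R \<eta> \<epsilon>)"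

definition closed_under_subobjects :: "('o, 'm) category \<Rightarrow> ('o, 'm) category \<Rightarrow> bool" where
  "closed_under_subobjects C S \<longleftrightarrow>
     (\<forall>m. monomorphism C m \<and> Cod C m \<in> Obj S \<longrightarrow> Dom C m \<in> Obj S)"

definition closed_under_factor_objects :: "('o, 'm) category \<Rightarrow> ('o, 'm) category \<Rightarrow> bool" where
  "closed_under_factor_objects C S \<longleftrightarrow>
     (\<forall>e. epimorphism C e \<and> Dom C e \<in> Obj S \<longrightarrow> Cod C e \<in> Obj S)"

text \<open>\<open>Fix (GF, \<eta>)\<close> and \<open>Fix (FG, \<epsilon>)\<close> are both instances of the following construction, for a
  family \<open>\<tau>\<close> of arrows indexed by objects.\<close>

definition Fix :: "('o, 'm) category \<Rightarrow> ('o \<Rightarrow> 'm) \<Rightarrow> ('o, 'm) category" where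
  "Fix C \<tau> = full_subcategory_on C {a. isomorphism C (\<tau> a)}"


section \<open>Modules of a monad and comodules of a comonad\<close>

text \<open>An arrow \<open>f\<close> of the base category may be a morphism between several different (co)modules
  with the same underlying objects, so arrows of the (co)module categories carry their source
  and target: they are triples \<open>(x, f, y)\<close>.\<close>

type_synonym ('o, 'm) structured_obj = "'o \<times> 'm"
type_synonym ('o, 'm) structured_arr =
  "('o, 'm) structured_obj \<times> 'm \<times> ('o, 'm) structured_obj"

definition monad_module ::
    "('o, 'm) category \<Rightarrow> ('o, 'm, 'o, 'm) functor_data \<Rightarrow> ('o \<Rightarrow> 'm) \<Rightarrow> ('o \<Rightarrow> 'm)
      \<Rightarrow> ('o, 'm) structured_obj \<Rightarrow> bool" where
  "monad_module C T \<mu> \<eta> = (\<lambda>(a, \<rho>).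
     a \<in> Obj C \<and> \<rho> \<in> Hom C (ObjMap T a) a \<and>
     \<rho> \<cdot>\<^bsub>C\<^esub> \<eta> a = Ident C a \<and>
     \<rho> \<cdot>\<^bsub>C\<^esub> ArrMap T \<rho> = \<rho> \<cdot>\<^bsub>C\<^esub> \<mu> a)"

definition module_category ::
    "('o, 'm) category \<Rightarrow> ('o, 'm, 'o, 'm) functor_data \<Rightarrow> ('o \<Rightarrow> 'm) \<Rightarrow> ('o \<Rightarrow> 'm)
      \<Rightarrow> (('o, 'm) structured_obj, ('o, 'm) structured_arr) category" where
  "module_category C T \<mu> \<eta> =
     \<lparr>Obj = {x. monad_module C T \<mu> \<eta> x},
      Arr = {(x, f, y). monad_module C T \<mu> \<eta> x \<and> monad_module C T \<mu> \<eta> y \<and>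
               f \<in> Hom C (fst x) (fst y) \<and> f \<cdot>\<^bsub>C\<^esub> snd x = snd y \<cdot>\<^bsub>C\<^esub> ArrMap T f},
      Dom = (\<lambda>(x, f, y). x),
      Cod = (\<lambda>(x, f, y). y),
      Ident = (\<lambda>x. (x, Ident C (fst x), x)),
      Comp = (\<lambda>(y, g, z) (x, f, y'). (x, g \<cdot>\<^bsub>C\<^esub> f, z))\<rparr>"

definition comonad_comodule ::
    "('o, 'm) category \<Rightarrow> ('o, 'm, 'o, 'm) functor_data \<Rightarrow> ('o \<Rightarrow> 'm) \<Rightarrow> ('o \<Rightarrow> 'm)
      \<Rightarrow> ('o, 'm) structured_obj \<Rightarrow> bool" where
  "comonad_comodule C S \<delta> \<epsilon> = (\<lambda>(b, \<rho>).
     b \<in> Obj C \<and> \<rho> \<in> Hom C b (ObjMap S b) \<and>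
     \<epsilon> b \<cdot>\<^bsub>C\<^esub> \<rho> = Ident C b \<and>
     ArrMap S \<rho> \<cdot>\<^bsub>C\<^esub> \<rho> = \<delta> b \<cdot>\<^bsub>C\<^esub> \<rho>)"

definition comodule_category ::
    "('o, 'm) category \<Rightarrow> ('o, 'm, 'o, 'm) functor_data \<Rightarrow> ('o \<Rightarrow> 'm) \<Rightarrow> ('o \<Rightarrow> 'm)
      \<Rightarrow> (('o, 'm) structured_obj, ('o, 'm) structured_arr) category" where
  "comodule_category C S \<delta> \<epsilon> =
     \<lparr>Obj = {x. comonad_comodule C S \<delta> \<epsilon> x},
      Arr = {(x, f, y). comonad_comodule C S \<delta> \<epsilon> x \<and> comonad_comodule C S \<delta> \<epsilon> y \<and>
               f \<in> Hom C (fst x) (fst y) \<and> snd y \<cdot>\<^bsub>C\<^esub> f = ArrMap S f \<cdot>\<^bsub>C\<^esub> snd x},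
      Dom = (\<lambda>(x, f, y). x),
      Cod = (\<lambda>(x, f, y). y),
      Ident = (\<lambda>x. (x, Ident C (fst x), x)),
      Comp = (\<lambda>(y, g, z) (x, f, y'). (x, g \<cdot>\<^bsub>C\<^esub> f, z))\<rparr>"

definition forgetful ::
    "(('o, 'm) structured_obj, ('o, 'm) structured_arr, 'o, 'm) functor_data" where
  "forgetful = \<lparr>ObjMap = fst, ArrMap = (\<lambda>(x, f, y). f)\<rparr>"

definition GF_modules ::
    "('o, 'm) category \<Rightarrow> ('o, 'm, 'p, 'n) functor_data \<Rightarrow> ('p, 'n, 'o, 'm) functor_data
      \<Rightarrow> ('o \<Rightarrow> 'm) \<Rightarrow> ('p \<Rightarrow> 'n)
      \<Rightarrow> (('o, 'm) structured_obj, ('o, 'm) structured_arr) category" where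
  "GF_modules A F G \<eta> \<epsilon> =
     module_category A (G \<circ>\<^sub>F F) (\<lambda>a. ArrMap G (\<epsilon> (ObjMap F a))) \<eta>"

definition FG_comodules ::
    "('p, 'n) category \<Rightarrow> ('o, 'm, 'p, 'n) functor_data \<Rightarrow> ('p, 'n, 'o, 'm) functor_data
      \<Rightarrow> ('o \<Rightarrow> 'm) \<Rightarrow> ('p \<Rightarrow> 'n)
      \<Rightarrow> (('p, 'n) structured_obj, ('p, 'n) structured_arr) category" where
  "FG_comodules B F G \<eta> \<epsilon> =
     comodule_category B (F \<circ>\<^sub>F G) (\<lambda>b. ArrMap F (\<eta> (ObjMap G b))) \<epsilon>"

definition F_tilde ::
    "('o, 'm, 'p, 'n) functor_data \<Rightarrow> ('o \<Rightarrow> 'm)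
      \<Rightarrow> (('o, 'm) structured_obj, ('o, 'm) structured_arr,
          ('p, 'n) structured_obj, ('p, 'n) structured_arr) functor_data" where
  "F_tilde F \<eta> =
     (let ob = (\<lambda>(a, \<rho>). (ObjMap F a, ArrMap F (\<eta> a)))
      in \<lparr>ObjMap = ob, ArrMap = (\<lambda>(x, f, y). (ob x, ArrMap F f, ob y))\<rparr>)"

definition G_tilde ::
    "('p, 'n, 'o, 'm) functor_data \<Rightarrow> ('p \<Rightarrow> 'n)
      \<Rightarrow> (('p, 'n) structured_obj, ('p, 'n) structured_arr,
          ('o, 'm) structured_obj, ('o, 'm) structured_arr) functor_data" where
  "G_tilde G \<epsilon> =
     (let ob = (\<lambda>(b, \<rho>). (ObjMap G b, ArrMap G (\<epsilon> b)))
      in \<lparr>ObjMap = ob, ArrMap = (\<lambda>(x, f, y). (ob x, ArrMap G f, ob y))\<rparr>)"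

end

theory Submission
  imports Defs
begin

text \<open>The triangle identities turn cancellability into invertibility: \<open>\<eta> (G b)\<close> has the
  retraction \<open>G (\<epsilon> b)\<close>, and an epimorphism with a retraction is an isomorphism. So once every
  \<open>\<eta> a\<close> is an epimorphism the monad \<open>GF\<close> is idempotent, and a structure map of a module on
  \<open>a\<close>, being a retraction of \<open>\<eta> a\<close>, is its inverse. Hence an object carries a module
  structure exactly when it lies in \<open>Fix (GF, \<eta>)\<close>, where \<open>GF\<close> provides the reflection
  (\<open>module_iff_retraction\<close>, \<open>underlying_objects_modules\<close>, \<open>reflective_Fix\<close>), and every
  arrow of the base between modules is a module morphism (\<open>retraction_natural\<close>).

  Extremality, beyond the epimorphism property, gives closure under subobjects: \<open>\<eta> a\<close> is
  a monomorphism as soon as \<open>a\<close> is a subobject of a fixed object, and an extremal epimorphism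
  that is a monomorphism is an isomorphism (\<open>closed_under_subobjects_Fix\<close>).

  The claims about \<open>FG\<close> are the claims about \<open>GF\<close> for the opposite adjunction, in which
  \<open>G\<close> is the left adjoint and \<open>\<epsilon>\<close> the unit. Finally, both (co)module categories have all base
  arrows as morphisms, so \<open>\<eta>\<close> and \<open>\<epsilon>\<close>, which are invertible on objects carrying a structure,
  lift to natural isomorphisms exhibiting the two functors between them as an equivalence
  (\<open>natural_isomorphism_lift_functor\<close>).\<close>


section \<open>Calculus in a category\<close>

lemma Hom_Arr: "f \<in> Hom C a b \<Longrightarrow> f \<in> Arr C"
  and Hom_Dom: "f \<in> Hom C a b \<Longrightarrow> Dom C f = a"
  and Hom_Cod: "f \<in> Hom C a b \<Longrightarrow> Cod C f = b"
  by (auto simp: Hom_def)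

lemma epimorphismD:
  assumes "epimorphism C e" "e \<in> Hom C a b" "f \<in> Hom C b c" "g \<in> Hom C b c"
    and "f \<cdot>\<^bsub>C\<^esub> e = g \<cdot>\<^bsub>C\<^esub> e"
  shows "f = g"
  using assms unfolding epimorphism_def by (auto simp: Hom_def)

lemma monomorphismD:
  assumes "monomorphism C m" "m \<in> Hom C a b" "f \<in> Hom C c a" "g \<in> Hom C c a"
    and "m \<cdot>\<^bsub>C\<^esub> f = m \<cdot>\<^bsub>C\<^esub> g"
  shows "f = g"
  using assms unfolding monomorphism_def by (auto simp: Hom_def)

lemma isomorphismI:
  assumes "f \<in> Hom C a b" "g \<in> Hom C b a"
    and "g \<cdot>\<^bsub>C\<^esub> f = Ident C a" "f \<cdot>\<^bsub>C\<^esub> g = Ident C b"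
  shows "isomorphism C f"
  using assms unfolding isomorphism_def by (auto simp: Hom_def)

lemma isomorphismE:
  assumes "isomorphism C f" "f \<in> Hom C a b"
  obtains g where "g \<in> Hom C b a" "g \<cdot>\<^bsub>C\<^esub> f = Ident C a" "f \<cdot>\<^bsub>C\<^esub> g = Ident C b"
  using assms unfolding isomorphism_def by (auto simp: Hom_def)

context category
begin

lemma Hom_Obj: "f \<in> Hom C a b \<Longrightarrow> a \<in> Obj C \<and> b \<in> Obj C"
  using Dom_in_Obj Cod_in_Obj by (auto simp: Hom_def)

lemma isomorphism_Ident: "a \<in> Obj C \<Longrightarrow> isomorphism C (Ident C a)"
  using Ident_in_Hom Comp_Ident_left by (blast intro: isomorphismI)

text \<open>\<open>e \<cdot> r\<close> and the identity agree after composition with \<open>e\<close>, which can be cancelled.\<close>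

lemma epi_retraction:
  assumes e: "epimorphism C e" "e \<in> Hom C a b" and r: "r \<in> Hom C b a"
    and re: "r \<cdot> e = Ident C a"
  shows "e \<cdot> r = Ident C b"
proof -
  have "(e \<cdot> r) \<cdot> e = e \<cdot> (r \<cdot> e)" using Comp_assoc e(2) r by blast
  also have "\<dots> = Ident C b \<cdot> e" using re e(2) Comp_Ident_left Comp_Ident_right by simp
  finally show ?thesis
    using epimorphismD[OF e] Comp_in_Hom[OF r e(2)] Ident_in_Hom Hom_Obj[OF r] by blast
qed

lemma epi_retraction_isomorphism:
  assumes "epimorphism C e" "e \<in> Hom C a b" "r \<in> Hom C b a" "r \<cdot> e = Ident C a"
  shows "isomorphism C e"
  using assms epi_retraction by (blast intro: isomorphismI)

text \<open>The trivial factorization \<open>e = e \<cdot> 1\<close> is enough to exploit extremality.\<close>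

lemma extremal_epi_mono_isomorphism:
  assumes e: "extremal_epimorphism C e" and m: "monomorphism C e"
  shows "isomorphism C e"
proof -
  have h: "e \<in> Hom C (Dom C e) (Cod C e)" using m by (simp add: monomorphism_def Hom_def)
  have i: "Ident C (Dom C e) \<in> Hom C (Dom C e) (Dom C e)"
    using Ident_in_Hom Hom_Obj[OF h] by blast
  have "e = e \<cdot> Ident C (Dom C e)" using Comp_Ident_right[OF h] by simp
  then show ?thesis
    using e m i h unfolding extremal_epimorphism_def by (auto simp: Hom_def)
qed

lemma mono_isomorphism_Comp:
  assumes m: "monomorphism C m" "m \<in> Hom C a b" and u: "isomorphism C u" "u \<in> Hom C b c"
  shows "monomorphism C (u \<cdot> m)"
proof -
  obtain v where v: "v \<in> Hom C c b" "v \<cdot> u = Ident C b" using u by (rule isomorphismE)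
  have um: "u \<cdot> m \<in> Hom C a c" using Comp_in_Hom m(2) u(2) by blast
  have "f = g" if f: "f \<in> Hom C x a" and g: "g \<in> Hom C x a"
    and eq: "(u \<cdot> m) \<cdot> f = (u \<cdot> m) \<cdot> g" for x f g
  proof -
    have "v \<cdot> ((u \<cdot> m) \<cdot> h) = m \<cdot> h" if h: "h \<in> Hom C x a" for h
    proof -
      have "v \<cdot> ((u \<cdot> m) \<cdot> h) = v \<cdot> (u \<cdot> (m \<cdot> h))" using Comp_assoc[OF h m(2) u(2)] by simp
      also have "\<dots> = (v \<cdot> u) \<cdot> (m \<cdot> h)"
        using Comp_assoc[OF Comp_in_Hom[OF h m(2)] u(2) v(1)] by simp
      also have "\<dots> = m \<cdot> h" using v(2) Comp_Ident_left[OF Comp_in_Hom[OF h m(2)]] by simp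
      finally show ?thesis .
    qed
    then have "m \<cdot> f = m \<cdot> g" using f g eq by metis
    then show ?thesis using monomorphismD[OF m f g] by blast
  qed
  then show ?thesis
    unfolding monomorphism_def using um by (auto simp: Hom_Arr Hom_Dom Hom_Cod)
qed

lemma mono_of_Comp:
  assumes f: "f \<in> Hom C a b" and g: "g \<in> Hom C b c" and gf: "monomorphism C (g \<cdot> f)"
  shows "monomorphism C f"
proof -
  have "h = k" if h: "h \<in> Hom C x a" and k: "k \<in> Hom C x a" and eq: "f \<cdot> h = f \<cdot> k" for x h k
    using monomorphismD[OF gf Comp_in_Hom[OF f g] h k]
      Comp_assoc[OF h f g] Comp_assoc[OF k f g] eq by simp
  then show ?thesis
    unfolding monomorphism_def using f by (auto simp: Hom_Arr Hom_Dom Hom_Cod)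
qed

end

lemma Hom_full_subcategory_on:
  "f \<in> Hom (full_subcategory_on C X) a b \<longleftrightarrow> f \<in> Hom C a b \<and> a \<in> X \<and> b \<in> X"
  by (auto simp: Hom_def full_subcategory_on_def)

lemma full_subcategory_on_simps [simp]:
  "Obj (full_subcategory_on C X) = Obj C \<inter> X"
  "Dom (full_subcategory_on C X) = Dom C"
  "Cod (full_subcategory_on C X) = Cod C"
  "Ident (full_subcategory_on C X) = Ident C"
  "Comp (full_subcategory_on C X) = Comp C"
  by (simp_all add: full_subcategory_on_def)

lemma (in category) category_full_subcategory_on: "category (full_subcategory_on C X)"
proof
  fix f assume "f \<in> Arr (full_subcategory_on C X)"
  then have "f \<in> Hom C (Dom C f) (Cod C f)" "Dom C f \<in> X" "Cod C f \<in> X"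
    by (auto simp: full_subcategory_on_def Hom_def)
  then show "Dom (full_subcategory_on C X) f \<in> Obj (full_subcategory_on C X)"
    and "Cod (full_subcategory_on C X) f \<in> Obj (full_subcategory_on C X)"
    using Hom_Obj by auto
qed (auto simp: Hom_full_subcategory_on Ident_in_Hom Comp_in_Hom
    intro: Comp_Ident_left Comp_Ident_right Comp_assoc)

lemma (in category) subcategory_full_subcategory_on: "subcategory C (full_subcategory_on C X)"
  unfolding subcategory_def
  using category_axioms category_full_subcategory_on
  by (auto simp: full_subcategory_on_def)

lemma is_functor_id_into_full:
  assumes "category C"
  shows "is_functor (full_subcategory_on C X) C id_functor"
  using assms category.category_full_subcategory_on[OF assms]
  by (auto simp: is_functor_def is_functor_axioms_def id_functor_def Hom_full_subcategory_on)

lemma is_functor_id: "category C \<Longrightarrow> is_functor C C id_functor"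
  by (simp add: is_functor_def is_functor_axioms_def id_functor_def)

lemma is_functor_comp:
  assumes "is_functor C D F" "is_functor D E G"
  shows "is_functor C E (G \<circ>\<^sub>F F)"
proof -
  interpret F: is_functor C D F by fact
  interpret G: is_functor D E G by fact
  show ?thesis
  proof
    fix f g a b c assume f: "f \<in> Hom C a b" and g: "g \<in> Hom C b c"
    show "ArrMap (G \<circ>\<^sub>F F) (g \<cdot>\<^bsub>C\<^esub> f) = ArrMap (G \<circ>\<^sub>F F) g \<cdot>\<^bsub>E\<^esub> ArrMap (G \<circ>\<^sub>F F) f"
      using F.ArrMap_Comp[OF f g] G.ArrMap_Comp[OF F.ArrMap_in_Hom[OF f] F.ArrMap_in_Hom[OF g]]
      by (simp add: comp_functor_def)
  qed (simp_all add: comp_functor_def F.ObjMap_in_Obj G.ObjMap_in_Obj F.ArrMap_in_Hom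
      G.ArrMap_in_Hom F.ArrMap_Ident G.ArrMap_Ident)
qed


section \<open>Duality\<close>

definition op_category :: "('o, 'm) category \<Rightarrow> ('o, 'm) category" where
  "op_category C = C\<lparr>Dom := Cod C, Cod := Dom C, Comp := (\<lambda>g f. f \<cdot>\<^bsub>C\<^esub> g)\<rparr>"

lemma op_category_simps [simp]:
  "Obj (op_category C) = Obj C"
  "Arr (op_category C) = Arr C"
  "Dom (op_category C) = Cod C"
  "Cod (op_category C) = Dom C"
  "Ident (op_category C) = Ident C"
  "g \<cdot>\<^bsub>op_category C\<^esub> f = f \<cdot>\<^bsub>C\<^esub> g"
  "op_category (op_category C) = C"
  by (simp_all add: op_category_def)

lemma Hom_op [simp]: "Hom (op_category C) a b = Hom C b a"
  by (auto simp: Hom_def)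

lemma monomorphism_op [simp]: "monomorphism (op_category C) = epimorphism C"
  and epimorphism_op [simp]: "epimorphism (op_category C) = monomorphism C"
  by (auto simp: monomorphism_def epimorphism_def fun_eq_iff)

lemma isomorphism_op [simp]: "isomorphism (op_category C) = isomorphism C"
  by (auto simp: isomorphism_def fun_eq_iff)

lemma extremal_epimorphism_op:
  "extremal_epimorphism (op_category C) f \<longleftrightarrow> extremal_monomorphism C f"
  unfolding extremal_epimorphism_def extremal_monomorphism_def by simp metis

lemma Fix_op: "Fix (op_category C) \<tau> = op_category (Fix C \<tau>)"
  unfolding Fix_def isomorphism_op
  by (rule category.equality) (auto simp: full_subcategory_on_def op_category_def)

lemma category_op:
  assumes "category C" shows "category (op_category C)"
proof -
  interpret category C by fact
  show ?thesis
    by standard (auto simp: Dom_in_Obj Cod_in_Obj Ident_in_Hom Comp_in_Hom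
        intro: Comp_Ident_left Comp_Ident_right Comp_assoc[symmetric])
qed

lemma is_functor_op:
  assumes "is_functor C D F" shows "is_functor (op_category C) (op_category D) F"
proof -
  interpret is_functor C D F by fact
  show ?thesis
    using category_op[OF C.category_axioms] category_op[OF D.category_axioms]
      ObjMap_in_Obj ArrMap_in_Hom ArrMap_Ident ArrMap_Comp
    by (auto simp: is_functor_def is_functor_axioms_def)
qed

lemma natural_transformation_op:
  assumes "natural_transformation C D F G \<tau>"
  shows "natural_transformation (op_category C) (op_category D) G F \<tau>"
  using assms
  by (simp add: natural_transformation_def natural_transformation_axioms_def is_functor_op)

lemma adjunction_op:
  assumes "adjunction A B F G \<eta> \<epsilon>"
  shows "adjunction (op_category B) (op_category A) G F \<epsilon> \<eta>"
  using assms
  by (simp add: adjunction_def adjunction_axioms_def is_functor_op natural_transformation_op)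

lemma coreflective_subcategory_iff_op:
  "coreflective_subcategory C S \<longleftrightarrow> reflective_subcategory (op_category C) (op_category S)"
proof -
  have sub: "subcategory (op_category C) (op_category S)" if "subcategory C S"
    for C S :: "('a, 'b) category"
    using that by (auto simp: subcategory_def category_op)
  have "subcategory C S \<longleftrightarrow> subcategory (op_category C) (op_category S)"
    using sub[of C S] sub[of "op_category C" "op_category S"] by auto
  moreover have "adjunction S C id_functor R \<eta> \<epsilon>
      \<longleftrightarrow> adjunction (op_category C) (op_category S) R id_functor \<epsilon> \<eta>" for R \<eta> \<epsilon>
    using adjunction_op[of S C id_functor R \<eta> \<epsilon>]
      adjunction_op[of "op_category C" "op_category S" R id_functor \<epsilon> \<eta>] by auto
  ultimately show ?thesis
    unfolding coreflective_subcategory_def reflective_subcategory_def by blast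
qed

lemma closed_under_factor_objects_op:
  "closed_under_subobjects (op_category C) (op_category S) \<longleftrightarrow> closed_under_factor_objects C S"
  by (simp add: closed_under_subobjects_def closed_under_factor_objects_def)

lemma monad_module_op: "monad_module (op_category C) = comonad_comodule C"
  by (simp add: monad_module_def comonad_comodule_def fun_eq_iff)


section \<open>Categories of objects with extra structure\<close>

text \<open>When every arrow of the base respects the structures, the category of structured objects
  is determined by the set \<open>X\<close> of its objects. This single construction therefore covers modules
  and comodules alike, and reduces every claim about them to a claim about the base.\<close>

definition lift_category ::
    "('o, 'm) category \<Rightarrow> ('o, 'm) structured_obj set
      \<Rightarrow> (('o, 'm) structured_obj, ('o, 'm) structured_arr) category" where
  "lift_category C X =
     \<lparr>Obj = X,
      Arr = {(x, f, y). x \<in> X \<and> y \<in> X \<and> f \<in> Hom C (fst x) (fst y)},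
      Dom = (\<lambda>(x, f, y). x),
      Cod = (\<lambda>(x, f, y). y),
      Ident = (\<lambda>x. (x, Ident C (fst x), x)),
      Comp = (\<lambda>(y, g, z) (x, f, y'). (x, g \<cdot>\<^bsub>C\<^esub> f, z))\<rparr>"

definition lift_functor ::
    "('o, 'm, 'p, 'n) functor_data \<Rightarrow> (('o, 'm) structured_obj \<Rightarrow> ('p, 'n) structured_obj)
      \<Rightarrow> (('o, 'm) structured_obj, ('o, 'm) structured_arr,
          ('p, 'n) structured_obj, ('p, 'n) structured_arr) functor_data" where
  "lift_functor F h = \<lparr>ObjMap = h, ArrMap = (\<lambda>(x, f, y). (h x, ArrMap F f, h y))\<rparr>"

lemma lift_category_simps [simp]:
  "Obj (lift_category C X) = X"
  "Ident (lift_category C X) x = (x, Ident C (fst x), x)"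
  "(y, g, z) \<cdot>\<^bsub>lift_category C X\<^esub> (x, f, y') = (x, g \<cdot>\<^bsub>C\<^esub> f, z)"
  by (simp_all add: lift_category_def)

lemma Hom_lift_category:
  "t \<in> Hom (lift_category C X) x y
    \<longleftrightarrow> x \<in> X \<and> y \<in> X \<and> (\<exists>f \<in> Hom C (fst x) (fst y). t = (x, f, y))"
  by (auto simp: Hom_def lift_category_def)

lemma lift_functor_simps [simp]:
  "ObjMap (lift_functor F h) x = h x"
  "ArrMap (lift_functor F h) (x, f, y) = (h x, ArrMap F f, h y)"
  by (simp_all add: lift_functor_def)

lemma lift_functor_id: "lift_functor id_functor (\<lambda>x. x) = id_functor"
  by (auto simp: lift_functor_def id_functor_def)

lemma lift_functor_comp:
  "lift_functor G k \<circ>\<^sub>F lift_functor F h = lift_functor (G \<circ>\<^sub>F F) (\<lambda>x. k (h x))"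
  by (auto simp: lift_functor_def comp_functor_def)

lemma category_lift_category:
  assumes "category C" and X: "fst ` X \<subseteq> Obj C"
  shows "category (lift_category C X)"
proof -
  interpret category C by fact
  show ?thesis
    by standard (use X in \<open>auto simp: Hom_lift_category Ident_in_Hom Comp_in_Hom
      Comp_Ident_left Comp_Ident_right Comp_assoc\<close>, auto simp: lift_category_def)
qed

lemma isomorphism_lift_category:
  assumes "isomorphism C f" "f \<in> Hom C (fst x) (fst y)" "x \<in> X" "y \<in> X"
  shows "isomorphism (lift_category C X) (x, f, y)"
  using assms(1,2)
proof (rule isomorphismE)
  fix g assume "g \<in> Hom C (fst y) (fst x)"
    "g \<cdot>\<^bsub>C\<^esub> f = Ident C (fst x)" "f \<cdot>\<^bsub>C\<^esub> g = Ident C (fst y)"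
  then show ?thesis
    using assms by (intro isomorphismI[where a = x and b = y and g = "(y, g, x)"])
      (auto simp: Hom_lift_category)
qed

lemma is_functor_lift_functor:
  assumes F: "is_functor C D F" and X: "fst ` X \<subseteq> Obj C" and Y: "fst ` Y \<subseteq> Obj D"
    and h: "\<And>x. x \<in> X \<Longrightarrow> h x \<in> Y" "\<And>x. x \<in> X \<Longrightarrow> fst (h x) = ObjMap F (fst x)"
  shows "is_functor (lift_category C X) (lift_category D Y) (lift_functor F h)"
proof -
  interpret F: is_functor C D F by fact
  interpret L: category "lift_category C X"
    using F.C.category_axioms X by (rule category_lift_category)
  interpret M: category "lift_category D Y"
    using F.D.category_axioms Y by (rule category_lift_category)
  show ?thesis
    by standard (use X in \<open>auto simp: Hom_lift_category h F.ArrMap_in_Hom F.ArrMap_Comp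
      F.ArrMap_Ident\<close>)
qed

lemma natural_isomorphism_lift_functor:
  assumes \<tau>: "natural_transformation C D F G \<tau>"
    and X: "fst ` X \<subseteq> Obj C" and Y: "fst ` Y \<subseteq> Obj D"
    and h: "\<And>x. x \<in> X \<Longrightarrow> h x \<in> Y" "\<And>x. x \<in> X \<Longrightarrow> fst (h x) = ObjMap F (fst x)"
    and k: "\<And>x. x \<in> X \<Longrightarrow> k x \<in> Y" "\<And>x. x \<in> X \<Longrightarrow> fst (k x) = ObjMap G (fst x)"
    and iso: "\<And>x. x \<in> X \<Longrightarrow> isomorphism D (\<tau> (fst x))"
  shows "natural_isomorphism (lift_category C X) (lift_category D Y)
           (lift_functor F h) (lift_functor G k) (\<lambda>x. (h x, \<tau> (fst x), k x))"
proof -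
  interpret \<tau>: natural_transformation C D F G \<tau> by fact
  interpret H: is_functor "lift_category C X" "lift_category D Y" "lift_functor F h"
    using \<tau>.F.is_functor_axioms X Y h by (rule is_functor_lift_functor)
  interpret K: is_functor "lift_category C X" "lift_category D Y" "lift_functor G k"
    using \<tau>.G.is_functor_axioms X Y k by (rule is_functor_lift_functor)
  have c: "\<tau> (fst x) \<in> Hom D (fst (h x)) (fst (k x))" if "x \<in> X" for x
    using that X h k \<tau>.component_in_Hom by auto
  show ?thesis
  proof
    fix x assume "x \<in> Obj (lift_category C X)"
    then have x: "x \<in> X" by simp
    show "isomorphism (lift_category D Y) (h x, \<tau> (fst x), k x)"
      using iso[OF x] c[OF x] h(1)[OF x] k(1)[OF x] by (rule isomorphism_lift_category)
  qed (auto simp: Hom_lift_category h(1) k(1) c \<tau>.naturality)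
qed

text \<open>Two structures on the same underlying object are isomorphic through its identity, so
  choosing one structure for each underlying object gives an inverse of the forgetful functor.\<close>

lemma equivalence_functor_forgetful:
  assumes "category C" and X: "fst ` X = Obj C \<inter> Y"
  shows "equivalence_functor (lift_category C X) (full_subcategory_on C Y) forgetful"
proof -
  let ?L = "lift_category C X" and ?S = "full_subcategory_on C Y"
  interpret C: category C by fact
  have XC: "fst ` X \<subseteq> Obj C" using X by simp
  interpret L: category ?L
    using assms(1) XC by (rule category_lift_category)
  interpret S: category ?S by (rule C.category_full_subcategory_on)
  define s where "s a = (SOME x. x \<in> X \<and> fst x = a)" for a
  have s: "s a \<in> X \<and> fst (s a) = a" if "a \<in> Obj C" "a \<in> Y" for a
  proof -
    have "a \<in> fst ` X" using that X by simp
    then have "\<exists>x. x \<in> X \<and> fst x = a" by auto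
    then show ?thesis unfolding s_def by (rule someI_ex)
  qed
  define K where "K = \<lparr>ObjMap = s, ArrMap = (\<lambda>f. (s (Dom C f), f, s (Cod C f)))\<rparr>"
  have sX: "s (fst x) \<in> X" "fst (s (fst x)) = fst x" "fst x \<in> Obj C" "fst x \<in> Y"
    if "x \<in> X" for x
  proof -
    have "fst x \<in> Obj C \<inter> Y" using imageI[OF that, of fst] X by simp
    then show "s (fst x) \<in> X" "fst (s (fst x)) = fst x" "fst x \<in> Obj C" "fst x \<in> Y"
      using s[of "fst x"] by auto
  qed
  have SH: "f \<in> Hom C a b \<and> a \<in> Y \<and> b \<in> Y \<and> a \<in> Obj C \<and> b \<in> Obj C \<and> Dom C f = a \<and> Cod C f = b"
    if "f \<in> Hom ?S a b" for f a b
    using that C.Hom_Obj by (auto simp: Hom_full_subcategory_on Hom_Dom Hom_Cod)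
  interpret U: is_functor ?L ?S forgetful
    by standard (auto simp: Hom_lift_category Hom_full_subcategory_on forgetful_def sX)
  interpret K: is_functor ?S ?L K
  proof
    fix a assume "a \<in> Obj ?S" then show "ObjMap K a \<in> Obj ?L" by (simp add: K_def s)
  next
    fix f a b assume "f \<in> Hom ?S a b"
    from SH[OF this] show "ArrMap K f \<in> Hom ?L (ObjMap K a) (ObjMap K b)"
      by (simp add: K_def s Hom_lift_category)
  next
    fix a assume a: "a \<in> Obj ?S"
    then have "Ident C a \<in> Hom C a a" by (simp add: C.Ident_in_Hom)
    then show "ArrMap K (Ident ?S a) = Ident ?L (ObjMap K a)"
      using a by (simp add: K_def s Hom_Dom Hom_Cod)
  next
    fix f g a b c assume f: "f \<in> Hom ?S a b" and g: "g \<in> Hom ?S b c"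
    from SH[OF f] SH[OF g] C.Comp_in_Hom[of f a b g c]
    show "ArrMap K (g \<cdot>\<^bsub>?S\<^esub> f) = ArrMap K g \<cdot>\<^bsub>?L\<^esub> ArrMap K f"
      by (auto simp: K_def Hom_Dom Hom_Cod)
  qed
  have 1: "natural_isomorphism ?L ?L id_functor (K \<circ>\<^sub>F forgetful)
      (\<lambda>x. (x, Ident C (fst x), s (fst x)))"
  proof -
    interpret I: is_functor ?L ?L id_functor by (rule is_functor_id) (rule L.category_axioms)
    interpret J: is_functor ?L ?L "K \<circ>\<^sub>F forgetful"
      by (rule is_functor_comp) (rule U.is_functor_axioms K.is_functor_axioms)+
    show ?thesis
    proof
      fix x assume "x \<in> Obj ?L"
      then have x: "x \<in> X" by simp
      have i: "Ident C (fst x) \<in> Hom C (fst x) (fst (s (fst x)))"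
        using sX[OF x] C.Ident_in_Hom by simp
      then show "(x, Ident C (fst x), s (fst x))
          \<in> Hom ?L (ObjMap id_functor x) (ObjMap (K \<circ>\<^sub>F forgetful) x)"
        using x sX[OF x]
        by (simp add: Hom_lift_category id_functor_def comp_functor_def K_def forgetful_def)
      show "isomorphism ?L (x, Ident C (fst x), s (fst x))"
        using C.isomorphism_Ident i x sX[OF x] by (intro isomorphism_lift_category) simp_all
    next
      fix t x y assume "t \<in> Hom ?L x y"
      then obtain f where t: "t = (x, f, y)" and f: "f \<in> Hom C (fst x) (fst y)"
        by (auto simp: Hom_lift_category)
      show "ArrMap (K \<circ>\<^sub>F forgetful) t \<cdot>\<^bsub>?L\<^esub> (x, Ident C (fst x), s (fst x))
          = (y, Ident C (fst y), s (fst y)) \<cdot>\<^bsub>?L\<^esub> ArrMap id_functor t"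
        using f by (simp add: t id_functor_def comp_functor_def K_def forgetful_def
            Hom_Dom Hom_Cod C.Comp_Ident_left C.Comp_Ident_right)
    qed
  qed
  have 2: "natural_isomorphism ?S ?S (forgetful \<circ>\<^sub>F K) id_functor (Ident C)"
  proof -
    interpret I: is_functor ?S ?S id_functor by (rule is_functor_id) (rule S.category_axioms)
    interpret J: is_functor ?S ?S "forgetful \<circ>\<^sub>F K"
      by (rule is_functor_comp) (rule U.is_functor_axioms K.is_functor_axioms)+
    show ?thesis
    proof
      fix a assume a: "a \<in> Obj ?S"
      then show "Ident C a \<in> Hom ?S (ObjMap (forgetful \<circ>\<^sub>F K) a) (ObjMap id_functor a)"
        by (simp add: Hom_full_subcategory_on s K_def forgetful_def comp_functor_def
            id_functor_def C.Ident_in_Hom)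
      show "isomorphism ?S (Ident C a)" using S.isomorphism_Ident[OF a] by simp
    next
      fix f a b assume "f \<in> Hom ?S a b"
      from SH[OF this] show "ArrMap id_functor f \<cdot>\<^bsub>?S\<^esub> Ident C a
          = Ident C b \<cdot>\<^bsub>?S\<^esub> ArrMap (forgetful \<circ>\<^sub>F K) f"
        by (auto simp: K_def forgetful_def comp_functor_def id_functor_def C.Comp_Ident_left
            C.Comp_Ident_right)
    qed
  qed
  show ?thesis
    unfolding equivalence_functor_def equivalence_def
    using U.is_functor_axioms K.is_functor_axioms 1 2 by blast
qed


section \<open>Adjunctions with epimorphic unit\<close>

context adjunction
begin

lemma unit_in_Hom: "a \<in> Obj A \<Longrightarrow> \<eta> a \<in> Hom A a (ObjMap G (ObjMap F a))"
  using unit.component_in_Hom by (simp add: id_functor_def comp_functor_def)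

lemma counit_in_Hom: "b \<in> Obj B \<Longrightarrow> \<epsilon> b \<in> Hom B (ObjMap F (ObjMap G b)) b"
  using counit.component_in_Hom by (simp add: id_functor_def comp_functor_def)

lemma unit_naturality:
  "f \<in> Hom A a a' \<Longrightarrow> ArrMap G (ArrMap F f) \<cdot>\<^bsub>A\<^esub> \<eta> a = \<eta> a' \<cdot>\<^bsub>A\<^esub> f"
  using unit.naturality[of f a a'] by (simp add: id_functor_def comp_functor_def)

lemma counit_naturality:
  "g \<in> Hom B b b' \<Longrightarrow> g \<cdot>\<^bsub>B\<^esub> \<epsilon> b = \<epsilon> b' \<cdot>\<^bsub>B\<^esub> ArrMap F (ArrMap G g)"
  using counit.naturality[of g b b'] by (simp add: id_functor_def comp_functor_def)

definition modules :: "('o, 'm) structured_obj set" where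
  "modules = {x. monad_module A (G \<circ>\<^sub>F F) (\<lambda>a. ArrMap G (\<epsilon> (ObjMap F a))) \<eta> x}"

text \<open>These are the values of the comparison functor from \<open>B\<close> to the modules; the
  associativity law is the naturality of \<open>\<epsilon>\<close> at \<open>\<epsilon> b\<close> under \<open>G\<close>.\<close>

lemma module_counit:
  assumes b: "b \<in> Obj B"
  shows "(ObjMap G b, ArrMap G (\<epsilon> b)) \<in> modules"
proof -
  note e = counit_in_Hom[OF b]
  have Ge: "ArrMap F (ArrMap G (\<epsilon> b))
      \<in> Hom B (ObjMap F (ObjMap G (ObjMap F (ObjMap G b)))) (ObjMap F (ObjMap G b))"
    using e F.ArrMap_in_Hom G.ArrMap_in_Hom by blast
  have e2: "\<epsilon> (ObjMap F (ObjMap G b))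
      \<in> Hom B (ObjMap F (ObjMap G (ObjMap F (ObjMap G b)))) (ObjMap F (ObjMap G b))"
    using counit_in_Hom F.ObjMap_in_Obj G.ObjMap_in_Obj b by blast
  have "ArrMap G (\<epsilon> b) \<cdot>\<^bsub>A\<^esub> ArrMap G (ArrMap F (ArrMap G (\<epsilon> b)))
      = ArrMap G (\<epsilon> b) \<cdot>\<^bsub>A\<^esub> ArrMap G (\<epsilon> (ObjMap F (ObjMap G b)))"
    using G.ArrMap_Comp[OF Ge e] G.ArrMap_Comp[OF e2 e] counit_naturality[OF e] by simp
  then show ?thesis
    unfolding modules_def monad_module_def
    using G.ArrMap_in_Hom[OF e] G.ObjMap_in_Obj[OF b] triangle_right[OF b]
    by (simp add: comp_functor_def)
qed

end

locale epi_unit_adjunction = adjunction A B F G \<eta> \<epsilon>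
  for A :: "('o, 'm) category" and B :: "('p, 'n) category" and F G \<eta> \<epsilon> +
  assumes unit_epi: "a \<in> Obj A \<Longrightarrow> epimorphism A (\<eta> a)"
begin

lemma isomorphism_unit_G:
  assumes b: "b \<in> Obj B" shows "isomorphism A (\<eta> (ObjMap G b))"
  using unit_epi[OF G.ObjMap_in_Obj[OF b]] unit_in_Hom[OF G.ObjMap_in_Obj[OF b]]
    G.ArrMap_in_Hom[OF counit_in_Hom[OF b]] triangle_right[OF b]
  by (rule F.C.epi_retraction_isomorphism)

text \<open>Idempotence of the monad: the two arrows agree after composition with the epimorphism
  \<open>\<eta> a\<close>, by naturality.\<close>

lemma GF_unit_eq_unit_GF:
  assumes a: "a \<in> Obj A"
  shows "ArrMap G (ArrMap F (\<eta> a)) = \<eta> (ObjMap G (ObjMap F a))"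
proof (rule epimorphismD[OF unit_epi[OF a] unit_in_Hom[OF a]])
  show "ArrMap G (ArrMap F (\<eta> a)) \<in> Hom A (ObjMap G (ObjMap F a))
      (ObjMap G (ObjMap F (ObjMap G (ObjMap F a))))"
    using unit_in_Hom[OF a] F.ArrMap_in_Hom G.ArrMap_in_Hom by blast
  show "\<eta> (ObjMap G (ObjMap F a)) \<in> Hom A (ObjMap G (ObjMap F a))
      (ObjMap G (ObjMap F (ObjMap G (ObjMap F a))))"
    using a unit_in_Hom F.ObjMap_in_Obj G.ObjMap_in_Obj by blast
  show "ArrMap G (ArrMap F (\<eta> a)) \<cdot>\<^bsub>A\<^esub> \<eta> a = \<eta> (ObjMap G (ObjMap F a)) \<cdot>\<^bsub>A\<^esub> \<eta> a"
    using unit_naturality[OF unit_in_Hom[OF a]] .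
qed

text \<open>Retractions of the unit are compatible with every arrow of the base: after composition
  with \<open>\<eta> a\<close> both sides become \<open>f\<close>. This makes every arrow between modules a module morphism,
  and inverses of the unit natural.\<close>

lemma retraction_natural:
  assumes f: "f \<in> Hom A a a'"
    and r: "r \<in> Hom A (ObjMap G (ObjMap F a)) a" "r \<cdot>\<^bsub>A\<^esub> \<eta> a = Ident A a"
    and r': "r' \<in> Hom A (ObjMap G (ObjMap F a')) a'" "r' \<cdot>\<^bsub>A\<^esub> \<eta> a' = Ident A a'"
  shows "f \<cdot>\<^bsub>A\<^esub> r = r' \<cdot>\<^bsub>A\<^esub> ArrMap G (ArrMap F f)"
proof -
  have a: "a \<in> Obj A" "a' \<in> Obj A" using F.C.Hom_Obj[OF f] by auto
  note u = unit_in_Hom[OF a(1)] and u' = unit_in_Hom[OF a(2)]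
  have GFf: "ArrMap G (ArrMap F f) \<in> Hom A (ObjMap G (ObjMap F a)) (ObjMap G (ObjMap F a'))"
    using f F.ArrMap_in_Hom G.ArrMap_in_Hom by blast
  have "(f \<cdot>\<^bsub>A\<^esub> r) \<cdot>\<^bsub>A\<^esub> \<eta> a = f"
    using F.C.Comp_assoc[OF u r(1) f] r(2) F.C.Comp_Ident_right[OF f] by simp
  moreover have "(r' \<cdot>\<^bsub>A\<^esub> ArrMap G (ArrMap F f)) \<cdot>\<^bsub>A\<^esub> \<eta> a = f"
    using F.C.Comp_assoc[OF u GFf r'(1)] unit_naturality[OF f] F.C.Comp_assoc[OF f u' r'(1)]
      r'(2) F.C.Comp_Ident_left[OF f] by simp
  ultimately show ?thesis
    using epimorphismD[OF unit_epi[OF a(1)] u F.C.Comp_in_Hom[OF r(1) f]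
        F.C.Comp_in_Hom[OF GFf r'(1)]] by simp
qed

text \<open>The associativity law comes for free, because it is an instance of
  \<open>retraction_natural\<close>.\<close>

lemma module_iff_retraction:
  "(a, r) \<in> modules \<longleftrightarrow>
     a \<in> Obj A \<and> r \<in> Hom A (ObjMap G (ObjMap F a)) a \<and> r \<cdot>\<^bsub>A\<^esub> \<eta> a = Ident A a"
proof
  assume "(a, r) \<in> modules"
  then show "a \<in> Obj A \<and> r \<in> Hom A (ObjMap G (ObjMap F a)) a \<and> r \<cdot>\<^bsub>A\<^esub> \<eta> a = Ident A a"
    by (simp add: modules_def monad_module_def comp_functor_def)
next
  assume r: "a \<in> Obj A \<and> r \<in> Hom A (ObjMap G (ObjMap F a)) a \<and> r \<cdot>\<^bsub>A\<^esub> \<eta> a = Ident A a"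
  then have Fa: "ObjMap F a \<in> Obj B" using F.ObjMap_in_Obj by blast
  \<comment> \<open>\<open>G (\<epsilon> (F a))\<close> is a retraction of the unit at \<open>G (F a)\<close>, so the associativity
    law is naturality of retractions at the arrow \<open>r\<close>.\<close>
  have "r \<cdot>\<^bsub>A\<^esub> ArrMap G (\<epsilon> (ObjMap F a)) = r \<cdot>\<^bsub>A\<^esub> ArrMap G (ArrMap F r)"
    using r G.ArrMap_in_Hom[OF counit_in_Hom[OF Fa]] triangle_right[OF Fa]
    by (intro retraction_natural) auto
  then show "(a, r) \<in> modules"
    using r by (simp add: modules_def monad_module_def comp_functor_def)
qed

lemma isomorphism_unit_module:
  assumes "x \<in> modules" shows "isomorphism A (\<eta> (fst x))"
proof -
  have a: "fst x \<in> Obj A" and r: "snd x \<in> Hom A (ObjMap G (ObjMap F (fst x))) (fst x)"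
    "snd x \<cdot>\<^bsub>A\<^esub> \<eta> (fst x) = Ident A (fst x)"
    using assms module_iff_retraction[of "fst x" "snd x"] by auto
  show ?thesis
    using unit_epi[OF a] unit_in_Hom[OF a] r by (rule F.C.epi_retraction_isomorphism)
qed

lemma underlying_objects_modules: "fst ` modules = Obj A \<inter> {a. isomorphism A (\<eta> a)}"
proof
  show "fst ` modules \<subseteq> Obj A \<inter> {a. isomorphism A (\<eta> a)}"
    using isomorphism_unit_module module_iff_retraction by fastforce
  show "Obj A \<inter> {a. isomorphism A (\<eta> a)} \<subseteq> fst ` modules"
  proof
    fix a assume a: "a \<in> Obj A \<inter> {a. isomorphism A (\<eta> a)}"
    then obtain r where "r \<in> Hom A (ObjMap G (ObjMap F a)) a" "r \<cdot>\<^bsub>A\<^esub> \<eta> a = Ident A a"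
      using isomorphismE[of A "\<eta> a" a "ObjMap G (ObjMap F a)"] unit_in_Hom by auto
    then have "(a, r) \<in> modules" using a module_iff_retraction by simp
    then show "a \<in> fst ` modules" by force
  qed
qed

lemma module_morphism:
  assumes "x \<in> modules" "y \<in> modules" "f \<in> Hom A (fst x) (fst y)"
  shows "f \<cdot>\<^bsub>A\<^esub> snd x = snd y \<cdot>\<^bsub>A\<^esub> ArrMap G (ArrMap F f)"
  using assms module_iff_retraction[of "fst x" "snd x"] module_iff_retraction[of "fst y" "snd y"]
  by (intro retraction_natural) auto

lemma GF_modules_eq_lift_category: "GF_modules A F G \<eta> \<epsilon> = lift_category A modules"
proof -
  have "monad_module A (G \<circ>\<^sub>F F) (\<lambda>a. ArrMap G (\<epsilon> (ObjMap F a))) \<eta> x \<longleftrightarrow> x \<in> modules" for x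
    by (simp add: modules_def)
  then show ?thesis
    unfolding GF_modules_def module_category_def lift_category_def
    using module_morphism by (auto simp: comp_functor_def)
qed

text \<open>The reflector is \<open>GF\<close>, with unit \<open>\<eta>\<close> and with the inverse of \<open>\<eta>\<close> as counit.\<close>

lemma reflective_Fix: "reflective_subcategory A (Fix A \<eta>)"
proof -
  let ?I = "{a. isomorphism A (\<eta> a)}"
  let ?S = "full_subcategory_on A ?I"
  interpret S: category ?S by (rule F.C.category_full_subcategory_on)
  define r where "r a = (SOME r. (a, r) \<in> modules)" for a
  have "(a, r a) \<in> modules" if "a \<in> Obj A" "a \<in> ?I" for a
    unfolding r_def by (rule someI_ex) (use that underlying_objects_modules in force)
  then have r: "r a \<in> Hom A (ObjMap G (ObjMap F a)) a" "r a \<cdot>\<^bsub>A\<^esub> \<eta> a = Ident A a"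
    if "a \<in> Obj A" "a \<in> ?I" for a
    using that module_iff_retraction by auto
  have GF: "ObjMap G (ObjMap F a) \<in> Obj A" "ObjMap G (ObjMap F a) \<in> ?I" if "a \<in> Obj A" for a
    using that F.ObjMap_in_Obj G.ObjMap_in_Obj isomorphism_unit_G by auto
  interpret L: is_functor A ?S "G \<circ>\<^sub>F F"
  proof
    fix a assume "a \<in> Obj A"
    then show "ObjMap (G \<circ>\<^sub>F F) a \<in> Obj ?S" using GF by (simp add: comp_functor_def)
  next
    fix f a b assume f: "f \<in> Hom A a b"
    then show "ArrMap (G \<circ>\<^sub>F F) f \<in> Hom ?S (ObjMap (G \<circ>\<^sub>F F) a) (ObjMap (G \<circ>\<^sub>F F) b)"
      using unit.G.ArrMap_in_Hom[OF f] F.C.Hom_Obj[OF f] GF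
      by (simp add: Hom_full_subcategory_on comp_functor_def)
  qed (simp_all add: unit.G.ArrMap_Ident unit.G.ArrMap_Comp)
  interpret J: is_functor ?S A id_functor
    by (rule is_functor_id_into_full) (rule F.C.category_axioms)
  have id_left: "id_functor \<circ>\<^sub>F H = H" for H :: "('o, 'm, 'o, 'm) functor_data"
    by (simp add: id_functor_def comp_functor_def)
  interpret u: natural_transformation A A id_functor "id_functor \<circ>\<^sub>F (G \<circ>\<^sub>F F)" \<eta>
    unfolding id_left by (rule unit.natural_transformation_axioms)
  interpret IS: is_functor ?S ?S id_functor by (rule is_functor_id) (rule S.category_axioms)
  interpret LJ: is_functor ?S ?S "(G \<circ>\<^sub>F F) \<circ>\<^sub>F id_functor"
    using J.is_functor_axioms L.is_functor_axioms by (rule is_functor_comp)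
  interpret c: natural_transformation ?S ?S "(G \<circ>\<^sub>F F) \<circ>\<^sub>F id_functor" id_functor r
  proof
    fix a assume "a \<in> Obj ?S"
    then show "r a \<in> Hom ?S (ObjMap ((G \<circ>\<^sub>F F) \<circ>\<^sub>F id_functor) a) (ObjMap id_functor a)"
      using r GF by (simp add: Hom_full_subcategory_on comp_functor_def id_functor_def)
  next
    fix f a b assume f: "f \<in> Hom ?S a b"
    then have "a \<in> Obj A" "a \<in> ?I" "b \<in> Obj A" "b \<in> ?I" "f \<in> Hom A a b"
      using F.C.Hom_Obj by (auto simp: Hom_full_subcategory_on)
    then show "ArrMap id_functor f \<cdot>\<^bsub>?S\<^esub> r a
        = r b \<cdot>\<^bsub>?S\<^esub> ArrMap ((G \<circ>\<^sub>F F) \<circ>\<^sub>F id_functor) f"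
      using retraction_natural r by (simp add: comp_functor_def id_functor_def)
  qed
  have "adjunction A ?S (G \<circ>\<^sub>F F) id_functor \<eta> r"
  proof
    fix a assume "a \<in> Obj A"
    then show "r (ObjMap (G \<circ>\<^sub>F F) a) \<cdot>\<^bsub>?S\<^esub> ArrMap (G \<circ>\<^sub>F F) (\<eta> a)
        = Ident ?S (ObjMap (G \<circ>\<^sub>F F) a)"
      using r GF by (simp add: comp_functor_def GF_unit_eq_unit_GF)
  next
    fix a assume "a \<in> Obj ?S"
    then show "ArrMap id_functor (r a) \<cdot>\<^bsub>A\<^esub> \<eta> (ObjMap id_functor a)
        = Ident A (ObjMap id_functor a)"
      using r by (simp add: id_functor_def)
  qed
  then show ?thesis
    unfolding reflective_subcategory_def Fix_def
    using F.C.subcategory_full_subcategory_on by blast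
qed

text \<open>For a monomorphism \<open>m\<close> into a fixed object \<open>a'\<close>, naturality identifies the
  monomorphism \<open>\<eta> a' \<cdot> m\<close> with \<open>GF m \<cdot> \<eta> a\<close>, so \<open>\<eta> a\<close> is a monomorphism; an extremal
  epimorphism that is a monomorphism is an isomorphism.\<close>

lemma closed_under_subobjects_Fix:
  assumes ext: "\<And>a. a \<in> Obj A \<Longrightarrow> extremal_epimorphism A (\<eta> a)"
  shows "closed_under_subobjects A (Fix A \<eta>)"
  unfolding closed_under_subobjects_def
proof (intro allI impI, elim conjE)
  fix m assume m: "monomorphism A m" and c: "Cod A m \<in> Obj (Fix A \<eta>)"
  let ?a = "Dom A m" and ?a' = "Cod A m"
  have hm: "m \<in> Hom A ?a ?a'" using m by (simp add: monomorphism_def Hom_def)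
  have a: "?a \<in> Obj A" "?a' \<in> Obj A" and iso: "isomorphism A (\<eta> ?a')"
    using F.C.Hom_Obj[OF hm] c by (auto simp: Fix_def)
  have GFm: "ArrMap G (ArrMap F m) \<in> Hom A (ObjMap G (ObjMap F ?a)) (ObjMap G (ObjMap F ?a'))"
    using hm F.ArrMap_in_Hom G.ArrMap_in_Hom by blast
  have "monomorphism A (\<eta> ?a' \<cdot>\<^bsub>A\<^esub> m)"
    using F.C.mono_isomorphism_Comp[OF m hm iso unit_in_Hom[OF a(2)]] .
  then have "monomorphism A (ArrMap G (ArrMap F m) \<cdot>\<^bsub>A\<^esub> \<eta> ?a)"
    using unit_naturality[OF hm] by simp
  then have "monomorphism A (\<eta> ?a)"
    using F.C.mono_of_Comp[OF unit_in_Hom[OF a(1)] GFm] by blast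
  then have "isomorphism A (\<eta> ?a)"
    using F.C.extremal_epi_mono_isomorphism ext a by blast
  then show "?a \<in> Obj (Fix A \<eta>)" using a by (simp add: Fix_def)
qed

lemma equivalence_functor_forgetful_modules:
  "equivalence_functor (GF_modules A F G \<eta> \<epsilon>) (Fix A \<eta>) forgetful"
  unfolding GF_modules_eq_lift_category Fix_def
  using F.C.category_axioms underlying_objects_modules by (rule equivalence_functor_forgetful)

lemma forgetful_image_modules:
  "ObjMap forgetful ` Obj (GF_modules A F G \<eta> \<epsilon>) = Obj (Fix A \<eta>)"
  using underlying_objects_modules
  by (simp add: GF_modules_eq_lift_category Fix_def forgetful_def)

end


section \<open>Equivalence of modules and comodules\<close>

text \<open>A comodule of \<open>FG\<close> is literally a module of the monad of the opposite adjunction. The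
  two categories still differ in the direction of their arrows, so the lift is taken over \<open>B\<close>
  and only the set of objects comes from the opposite side.\<close>

lemma FG_comodules_eq_lift_category:
  assumes "epi_unit_adjunction (op_category B) (op_category A) G F \<epsilon> \<eta>"
  shows "FG_comodules B F G \<eta> \<epsilon>
    = lift_category B (adjunction.modules (op_category B) G F \<epsilon> \<eta>)"
proof -
  interpret D: epi_unit_adjunction "op_category B" "op_category A" G F \<epsilon> \<eta> by fact
  have "comonad_comodule B (F \<circ>\<^sub>F G) (\<lambda>b. ArrMap F (\<eta> (ObjMap G b))) \<epsilon> x \<longleftrightarrow> x \<in> D.modules" for x
    by (simp add: D.modules_def monad_module_op)
  moreover have "snd y \<cdot>\<^bsub>B\<^esub> f = ArrMap (F \<circ>\<^sub>F G) f \<cdot>\<^bsub>B\<^esub> snd x"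
    if "x \<in> D.modules" "y \<in> D.modules" "f \<in> Hom B (fst x) (fst y)" for x y f
    using D.module_morphism[of y x f] that by (simp add: comp_functor_def)
  ultimately show ?thesis
    unfolding FG_comodules_def comodule_category_def lift_category_def by auto
qed

theorem mainTheorem6:
  fixes A :: "('o, 'm) category" and B :: "('p, 'n) category"
    and F :: "('o, 'm, 'p, 'n) functor_data" and G :: "('p, 'n, 'o, 'm) functor_data"
    and \<eta> :: "'o \<Rightarrow> 'm" and \<epsilon> :: "'p \<Rightarrow> 'n"
  assumes "adjunction A B F G \<eta> \<epsilon>"
    and "star_functors A B F G \<eta> \<epsilon>"
  shows "equivalence (GF_modules A F G \<eta> \<epsilon>) (FG_comodules B F G \<eta> \<epsilon>)
           (F_tilde F \<eta>) (G_tilde G \<epsilon>)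
       \<and> equivalence_functor (GF_modules A F G \<eta> \<epsilon>) (Fix A \<eta>) forgetful
       \<and> ObjMap forgetful ` Obj (GF_modules A F G \<eta> \<epsilon>) = Obj (Fix A \<eta>)
       \<and> reflective_subcategory A (Fix A \<eta>)
       \<and> closed_under_subobjects A (Fix A \<eta>)
       \<and> equivalence_functor (FG_comodules B F G \<eta> \<epsilon>) (Fix B \<epsilon>) forgetful
       \<and> ObjMap forgetful ` Obj (FG_comodules B F G \<eta> \<epsilon>) = Obj (Fix B \<epsilon>)
       \<and> coreflective_subcategory B (Fix B \<epsilon>)
       \<and> closed_under_factor_objects B (Fix B \<epsilon>)"
proof -
  have ext: "extremal_epimorphism A (\<eta> a)" if "a \<in> Obj A" for a
    using that assms(2) by (simp add: star_functors_def)
  have ext': "extremal_epimorphism (op_category B) (\<epsilon> b)" if "b \<in> Obj (op_category B)" for b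
    using that assms(2) by (simp add: star_functors_def extremal_epimorphism_op)
  interpret E: epi_unit_adjunction A B F G \<eta> \<epsilon>
    using assms(1) ext
    by (simp add: epi_unit_adjunction_def epi_unit_adjunction_axioms_def extremal_epimorphism_def)
  interpret D: epi_unit_adjunction "op_category B" "op_category A" G F \<epsilon> \<eta>
    using adjunction_op[OF assms(1)] ext'
    by (simp add: epi_unit_adjunction_def epi_unit_adjunction_axioms_def extremal_epimorphism_def)
  let ?h = "\<lambda>(a, \<rho>). (ObjMap F a, ArrMap F (\<eta> a))"
  let ?k = "\<lambda>(b, \<rho>). (ObjMap G b, ArrMap G (\<epsilon> b))"
  have M: "GF_modules A F G \<eta> \<epsilon> = lift_category A E.modules"
    by (rule E.GF_modules_eq_lift_category)
  have N: "FG_comodules B F G \<eta> \<epsilon> = lift_category B D.modules"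
    by (rule FG_comodules_eq_lift_category) (rule D.epi_unit_adjunction_axioms)
  have X: "fst ` E.modules = Obj A \<inter> {a. isomorphism A (\<eta> a)}"
    by (rule E.underlying_objects_modules)
  have Y: "fst ` D.modules = Obj B \<inter> {b. isomorphism B (\<epsilon> b)}"
    using D.underlying_objects_modules by simp
  have X': "fst ` E.modules \<subseteq> Obj A" and Y': "fst ` D.modules \<subseteq> Obj B"
    using X Y by auto
  have h: "?h x \<in> D.modules" "fst (?h x) = ObjMap F (fst x)" if "x \<in> E.modules" for x
    using that X' D.module_counit[of "fst x"] by (auto simp: case_prod_unfold)
  have k: "?k y \<in> E.modules" "fst (?k y) = ObjMap G (fst y)" if "y \<in> D.modules" for y
    using that Y' E.module_counit[of "fst y"] by (auto simp: case_prod_unfold)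
  have Ft: "F_tilde F \<eta> = lift_functor F ?h" and Gt: "G_tilde G \<epsilon> = lift_functor G ?k"
    by (simp_all add: F_tilde_def G_tilde_def lift_functor_def Let_def)
  have 1: "is_functor (lift_category A E.modules) (lift_category B D.modules) (lift_functor F ?h)"
    using E.F.is_functor_axioms X' Y' h by (rule is_functor_lift_functor)
  have 2: "is_functor (lift_category B D.modules) (lift_category A E.modules) (lift_functor G ?k)"
    using E.G.is_functor_axioms Y' X' k by (rule is_functor_lift_functor)
  have 3: "natural_isomorphism (lift_category A E.modules) (lift_category A E.modules)
      (lift_functor id_functor (\<lambda>x. x)) (lift_functor (G \<circ>\<^sub>F F) (\<lambda>x. ?k (?h x)))
      (\<lambda>x. (x, \<eta> (fst x), ?k (?h x)))"
    using E.unit.natural_transformation_axioms X' X'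
    by (rule natural_isomorphism_lift_functor)
      (use h k E.isomorphism_unit_module in \<open>auto simp: id_functor_def comp_functor_def\<close>)
  have 4: "natural_isomorphism (lift_category B D.modules) (lift_category B D.modules)
      (lift_functor (F \<circ>\<^sub>F G) (\<lambda>x. ?h (?k x))) (lift_functor id_functor (\<lambda>x. x))
      (\<lambda>x. (?h (?k x), \<epsilon> (fst x), x))"
    using E.counit.natural_transformation_axioms Y' Y'
    by (rule natural_isomorphism_lift_functor)
      (use h k D.isomorphism_unit_module in \<open>auto simp: id_functor_def comp_functor_def\<close>)
  have "equivalence (GF_modules A F G \<eta> \<epsilon>) (FG_comodules B F G \<eta> \<epsilon>) (F_tilde F \<eta>) (G_tilde G \<epsilon>)"
    unfolding equivalence_def M N Ft Gt lift_functor_comp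
    using 1 2 3[unfolded lift_functor_id] 4[unfolded lift_functor_id] by blast
  moreover have "equivalence_functor (FG_comodules B F G \<eta> \<epsilon>) (Fix B \<epsilon>) forgetful"
    unfolding N Fix_def using E.F.D.category_axioms Y by (rule equivalence_functor_forgetful)
  moreover have "ObjMap forgetful ` Obj (FG_comodules B F G \<eta> \<epsilon>) = Obj (Fix B \<epsilon>)"
    using Y by (simp add: N Fix_def forgetful_def)
  moreover have "coreflective_subcategory B (Fix B \<epsilon>)"
    using D.reflective_Fix by (simp add: coreflective_subcategory_iff_op Fix_op)
  moreover have "closed_under_factor_objects B (Fix B \<epsilon>)"
    using D.closed_under_subobjects_Fix[OF ext']
    by (simp add: Fix_op closed_under_factor_objects_op)
  ultimately show ?thesis
    using E.equivalence_functor_forgetful_modules E.forgetful_image_modules E.reflective_Fix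
      E.closed_under_subobjects_Fix[OF ext] by blast
qed

end
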